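(* Let $\Bbbk$ be a nonzero commutative ring and set, in $\Bbbk\langle x_1,x_2,y_1,y_2\rangle$, $$r_1=x_1x_2+y_1^2-y_1,\quad r_2=x_2x_1+y_2^2-y_2,\quad r_3=x_1y_2-y_1x_1,\quad r_4=x_2y_1-y_2x_2.$$ Let $B=\Bbbk\langle x_1,x_2,y_1,y_2\rangle/(r_1,r_2)$, augmented by sending all generators to $0$, and let $A=B/\bigcap_{n\ge1}I(B)^n$. Then $A$ has the presentation $$A=\Bbbk\langle x_1,x_2,y_1,y_2\mid r_1,r_2,r_3,r_4\rangle,$$ i.e. the kernel of the natural surjection $\Bbbk\langle x_1,x_2,y_1,y_2\rangle\to A$ is the ideal $(r_1,r_2,r_3,r_4)$. Moreover, with respect to the deg-lex order on the free monoid $W(x_1,x_2,y_1,y_2)$ with $x_1>x_2>y_1>y_2$, the set $R=\{r_1,r_2,r_3,r_4\}$ is a Gröbner–Shirshov basis in $\Bbbk\langle x_1,x_2,y_1,y_2\rangle$.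
   Context: For an augmented algebra $B$ (a $\Bbbk$-algebra with a homomorphism $\varepsilon_B:B\to\Bbbk$), $I(B)=\ker\varepsilon_B$. The deg-lex order compares words first by length and then, for equal length, lexicographically from the left. For a nonzero polynomial $p$, $\mathsf{MT}(p)$ is the largest word occurring in $p$ with nonzero coefficient; $p$ is monic if that coefficient is $1$. With $W$ the free monoid of words, a set $R$ of monic polynomials is a Gröbner–Shirshov basis if $W\,\mathsf{MT}(R)\,W=\mathsf{MT}((R)\setminus0)$, where $(R)$ is the two-sided ideal generated by $R$ and $\mathsf{MT}(T)=\{\mathsf{MT}(t):t\in T\}$. *)

theory Defs
  imports
    "HOL-Library.Poly_Mapping"
    "HOL-Algebra.QuotRing"
    "HOL-Algebra.Ideal_Product"
    "HOL-Algebra.Algebraic_Closure_Type"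
begin

section \<open>Free algebras\<close>

text \<open>
  Words are lists and form a monoid under concatenation. The library writes the monoid
  under the exponents of a \<open>\<Rightarrow>\<^sub>0\<close>-algebra additively, so the empty word is \<open>0\<close> and
  concatenation is \<open>+\<close>; the free algebra is then the convolution algebra of finitely
  supported coefficient functions on words.
\<close>

instantiation list :: (type) monoid_add
begin

definition zero_list :: "'a list" where "zero_list = []"

definition plus_list :: "'a list \<Rightarrow> 'a list \<Rightarrow> 'a list" where "plus_list = (@)"

instance
  by standard (simp_all add: zero_list_def plus_list_def)

end

type_synonym ('x, 'k) free_alg = "'x list \<Rightarrow>\<^sub>0 'k"

definition gvar :: "'x \<Rightarrow> ('x, 'k::comm_ring_1) free_alg"
  where "gvar x = Poly_Mapping.single [x] 1"

abbreviation free_ring :: "('x, 'k::comm_ring_1) free_alg ring"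
  where "free_ring \<equiv> ring_of_type_algebra"

text \<open>The \<open>'k\<close>-algebra homomorphism to \<open>'k\<close> that sends each generator \<open>x\<close> to \<open>\<phi> x\<close>.\<close>

definition eval_free :: "('x \<Rightarrow> 'k) \<Rightarrow> ('x, 'k::comm_ring_1) free_alg \<Rightarrow> 'k"
  where "eval_free \<phi> p =
    (\<Sum>w\<in>Poly_Mapping.keys p. Poly_Mapping.lookup p w * prod_list (map \<phi> w))"


section \<open>Groebner-Shirshov bases\<close>

text \<open>\<open>r\<close> is a strict total order on words; the value at \<open>p = 0\<close> is unspecified.\<close>

definition MT :: "'x list rel \<Rightarrow> ('x, 'k::comm_ring_1) free_alg \<Rightarrow> 'x list"
  where "MT r p = (THE w. w \<in> Poly_Mapping.keys p \<and>
    (\<forall>v\<in>Poly_Mapping.keys p. v \<noteq> w \<longrightarrow> (v, w) \<in> r))"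

definition monic :: "'x list rel \<Rightarrow> ('x, 'k::comm_ring_1) free_alg \<Rightarrow> bool"
  where "monic r p \<longleftrightarrow> p \<noteq> 0 \<and> Poly_Mapping.lookup p (MT r p) = 1"

definition GS_basis :: "'x list rel \<Rightarrow> ('x, 'k::comm_ring_1) free_alg set \<Rightarrow> bool"
  where "GS_basis r R \<longleftrightarrow> (\<forall>p\<in>R. monic r p) \<and>
    {u @ m @ v | u m v. m \<in> MT r ` R} = MT r ` (genideal free_ring R - {0})"


section \<open>The algebras \<open>B\<close> and \<open>A\<close>\<close>

datatype gen = X1 | X2 | Y1 | Y2

text \<open>\<open>(a, b)\<close> means \<open>a < b\<close>, so this is \<open>X1 > X2 > Y1 > Y2\<close>.\<close>

definition gen_less :: "gen rel"
  where "gen_less = {(Y2, Y1), (Y2, X2), (Y2, X1), (Y1, X2), (Y1, X1), (X2, X1)}"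

definition deglex :: "gen list rel"
  where "deglex = lenlex gen_less"

definition r1 :: "(gen, 'k::comm_ring_1) free_alg"
  where "r1 = gvar X1 * gvar X2 + (gvar Y1)^2 - gvar Y1"

definition r2 :: "(gen, 'k::comm_ring_1) free_alg"
  where "r2 = gvar X2 * gvar X1 + (gvar Y2)^2 - gvar Y2"

definition r3 :: "(gen, 'k::comm_ring_1) free_alg"
  where "r3 = gvar X1 * gvar Y2 - gvar Y1 * gvar X1"

definition r4 :: "(gen, 'k::comm_ring_1) free_alg"
  where "r4 = gvar X2 * gvar Y1 - gvar Y2 * gvar X2"

definition algB :: "(gen, 'k::comm_ring_1) free_alg set ring"
  where "algB = free_ring Quot (genideal free_ring {r1, r2})"

text \<open>
  An element of \<open>B\<close> is a coset, on which evaluation at \<open>0\<close> is constant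
  (see \<open>augB_coset\<close> below); \<open>augB\<close> takes that constant value.
\<close>

definition augB :: "(gen, 'k::comm_ring_1) free_alg set \<Rightarrow> 'k"
  where "augB S = the_elem (eval_free (\<lambda>_. 0) ` S)"

definition IB :: "(gen, 'k::comm_ring_1) free_alg set set"
  where "IB = a_kernel algB (ring_of_type_algebra :: 'k ring) augB"

text \<open>The monoid \<open>ideals_set algB\<close> provides the powers of an ideal, with
  \<open>I\<^sup>0\<close> the whole ring.\<close>

definition IB_inf :: "(gen, 'k::comm_ring_1) free_alg set set"
  where "IB_inf = (\<Inter>n\<in>{1::nat..}. IB [^]\<^bsub>ideals_set algB\<^esub> n)"

definition algA :: "(gen, 'k::comm_ring_1) free_alg set set ring"
  where "algA = algB Quot IB_inf"

definition natA :: "(gen, 'k::comm_ring_1) free_alg \<Rightarrow> (gen, 'k) free_alg set set"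
  where "natA f = IB_inf +>\<^bsub>algB\<^esub> (genideal free_ring {r1, r2} +>\<^bsub>free_ring\<^esub> f)"


section \<open>The augmentation is well defined\<close>

lemma eval_free_0:
  fixes p :: "('x, 'k::comm_ring_1) free_alg"
  shows "eval_free (\<lambda>_. 0) p = Poly_Mapping.lookup p []"
proof -
  have *: "prod_list (map (\<lambda>_. 0::'k) w) = (if w = [] then 1 else 0)" for w :: "'x list"
    by (cases w) auto
  show ?thesis
    by (simp add: eval_free_def * if_distrib [where f="\<lambda>x. _ * x"] sum.delta' in_keys_iff
        cong: if_cong)
qed

lemma lookup_mult_Nil:
  fixes p q :: "('x, 'k::comm_ring_1) free_alg"
  shows "Poly_Mapping.lookup (p * q) [] = Poly_Mapping.lookup p [] * Poly_Mapping.lookup q []"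
proof -
  have "([]::'x list) = l + r \<longleftrightarrow> l = [] \<and> r = []" for l r
    by (auto simp: plus_list_def)
  then have "Poly_Mapping.lookup (p * q) [] =
    (\<Sum>l. Poly_Mapping.lookup p l * (\<Sum>r. Poly_Mapping.lookup q r when l = [] \<and> r = []))"
    by (simp add: lookup_mult)
  also have "\<dots> = (\<Sum>l. (Poly_Mapping.lookup p l * Poly_Mapping.lookup q []) when l = [])"
    by (intro Sum_any.cong) (auto simp: when_def)
  finally show ?thesis by simp
qed

lemma eval_0_hom:
  "eval_free (\<lambda>_. 0) \<in> ring_hom free_ring (ring_of_type_algebra :: 'k::comm_ring_1 ring)"
  by (rule ring_hom_memI)
     (auto simp: ring_of_type_algebra_def eval_free_0 lookup_mult_Nil lookup_add
       lookup_one zero_list_def)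

lemma eval_0_var: "eval_free (\<lambda>_. 0) (gvar x) = 0"
  by (simp add: eval_free_0 gvar_def lookup_single)

lemma ring_free: "ring (free_ring :: ('x, 'k::comm_ring_1) free_alg ring)"
proof -
  have "\<exists>y. x + y = 0" for x :: "('x, 'k) free_alg"
    using add.right_inverse by blast
  then show ?thesis
    unfolding ring_of_type_algebra_def using add.right_inverse
    by unfold_locales (auto simp: algebra_simps Units_def)
qed

lemma augB_coset:
  fixes f :: "(gen, 'k::comm_ring_1) free_alg"
  shows "augB (genideal free_ring {r1, r2} +>\<^bsub>free_ring\<^esub> f) = eval_free (\<lambda>_. 0) f"
proof -
  interpret F: ring "free_ring :: (gen, 'k) free_alg ring" by (rule ring_free)
  interpret h: ring_hom_ring "free_ring :: (gen, 'k) free_alg ring"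
    "ring_of_type_algebra :: 'k ring" "eval_free (\<lambda>_. 0)"
    by (intro ring_hom_ringI2 ring_free ring_from_type_algebra eval_0_hom)
  let ?K = "a_kernel (free_ring :: (gen, 'k) free_alg ring) (ring_of_type_algebra :: 'k ring)
    (eval_free (\<lambda>_. 0))"
  have "{r1, r2} \<subseteq> ?K"
    by (auto simp: a_kernel_def' ring_of_type_algebra_def eval_free_0 r1_def r2_def gvar_def
        lookup_minus lookup_add lookup_mult_Nil power2_eq_square lookup_single)
  then have sub: "genideal free_ring {r1, r2} \<subseteq> ?K"
    by (rule F.genideal_minimal[OF h.kernel_is_ideal])
  have zero: "(0::(gen, 'k) free_alg) \<in> genideal free_ring {r1, r2}"
    using additive_subgroup.zero_closed[OF ideal.axioms(1)[OF F.genideal_ideal[of "{r1, r2}"]]]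
    by (simp add: ring_of_type_algebra_def)
  have "eval_free (\<lambda>_. 0) ` (genideal free_ring {r1, r2} +>\<^bsub>free_ring\<^esub> f) =
    {eval_free (\<lambda>_. 0) f}"
    using sub zero
    by (force simp: a_r_coset_def' a_kernel_def' ring_of_type_algebra_def eval_free_0 lookup_add
        subset_iff)
  then show ?thesis by (simp add: augB_def)
qed

end

theory Submission
  imports Defs
begin

text \<open>
  In \<open>B\<close> the overlap \<open>x\<^sub>1x\<^sub>2x\<^sub>1\<close> gives \<open>r\<^sub>3 = r\<^sub>3y\<^sub>2 + y\<^sub>1r\<^sub>3\<close>, so \<open>r\<^sub>3\<close> lies in every power of \<open>I(B)\<close>,
  and likewise \<open>r\<^sub>4\<close>. Conversely, let \<open>g(t) = t + g(t)\<^sup>2\<close> be the Catalan series. Sending \<open>y\<^sub>1\<close> to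
  \<open>g(x\<^sub>1x\<^sub>2)\<close> and \<open>y\<^sub>2\<close> to \<open>g(x\<^sub>2x\<^sub>1)\<close> kills all four relations and maps the free algebra to the
  power series in \<open>x\<^sub>1, x\<^sub>2\<close>, respecting order. The lowest term of a word arises by replacing
  \<open>y\<^sub>1, y\<^sub>2\<close> by \<open>x\<^sub>1x\<^sub>2, x\<^sub>2x\<^sub>1\<close>, which is injective on the words without a factor
  \<open>x\<^sub>1x\<^sub>2, x\<^sub>2x\<^sub>1, x\<^sub>1y\<^sub>2, x\<^sub>2y\<^sub>1\<close>. Hence these normal words, which span modulo \<open>(r\<^sub>1, r\<^sub>2, r\<^sub>3, r\<^sub>4)\<close> by
  reduction, stay independent in power series. This shows at once that the quotient by
  \<open>(r\<^sub>1, r\<^sub>2, r\<^sub>3, r\<^sub>4)\<close> is residually nilpotent and that the four relations are a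
  Groebner-Shirshov basis, without any check of overlaps.
\<close>

section \<open>Free algebras\<close>

abbreviation (input) wd :: "'x list \<Rightarrow> ('x, 'k::comm_ring_1) free_alg"
  where "wd w \<equiv> Poly_Mapping.single w 1"

lemma free_alg_sum:
  fixes p :: "('x, 'k::comm_ring_1) free_alg"
  shows "p = (\<Sum>w\<in>Poly_Mapping.keys p. Poly_Mapping.single w (Poly_Mapping.lookup p w))"
  by (rule poly_mapping_eqI)
     (auto simp: lookup_sum lookup_single when_def sum.delta in_keys_iff)

lemma free_alg_induct [case_names zero single add]:
  fixes p :: "('x, 'k::comm_ring_1) free_alg"
  assumes "P 0" "\<And>w c. P (Poly_Mapping.single w c)" "\<And>a b. P a \<Longrightarrow> P b \<Longrightarrow> P (a + b)"
  shows "P p"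
proof -
  have "P (\<Sum>w\<in>A. Poly_Mapping.single w (Poly_Mapping.lookup p w))" if "finite A" for A
    using that by induction (auto intro: assms)
  from this[OF finite_keys] show ?thesis by (subst free_alg_sum)
qed

lemma single_Nil_one [simp]: "Poly_Mapping.single [] 1 = 1"
  by (simp flip: zero_list_def)

text \<open>The elements \<open>Poly_Mapping.single [] c\<close> are the scalars; they are central
  because \<open>'k\<close> is commutative, and this makes \<open>subst\<close>
  multiplicative.\<close>

lemma single_Nil_central:
  fixes p :: "('x, 'k::comm_ring_1) free_alg"
  shows "Poly_Mapping.single [] c * p = p * Poly_Mapping.single [] c"
  by (induction p rule: free_alg_induct)
     (auto simp: mult_single plus_list_def algebra_simps)

lemma lookup_single_Nil_mult:
  fixes p :: "('x, 'k::comm_ring_1) free_alg"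
  shows "Poly_Mapping.lookup (Poly_Mapping.single [] c * p) w = c * Poly_Mapping.lookup p w"
  by (induction p rule: free_alg_induct)
     (auto simp: mult_single plus_list_def algebra_simps lookup_add lookup_single when_def)

text \<open>The universal property of the free algebra: the unique \<open>'k\<close>-algebra
  homomorphism extending \<open>f\<close> from the generators.\<close>

definition subst :: "('x \<Rightarrow> ('y, 'k::comm_ring_1) free_alg) \<Rightarrow> ('x, 'k) free_alg \<Rightarrow> ('y, 'k) free_alg"
  where "subst f p = (\<Sum>w\<in>Poly_Mapping.keys p.
    Poly_Mapping.single [] (Poly_Mapping.lookup p w) * prod_list (map f w))"

lemma subst_zero [simp]: "subst f 0 = 0"
  by (simp add: subst_def)

lemma subst_single:
  "subst f (Poly_Mapping.single w c) = Poly_Mapping.single [] c * prod_list (map f w)"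
  by (simp add: subst_def)

lemma subst_gvar [simp]: "subst f (gvar x) = f x"
  by (simp add: gvar_def subst_single)

lemma subst_add: "subst f (p + q) = subst f p + subst f q"
  unfolding subst_def
  by (rule setsum_keys_plus_distrib) (simp_all add: single_add distrib_right)

lemma subst_diff: "subst f (p - q) = subst f p - subst f q"
  using subst_add[of f "p - q" q] by simp

lemma subst_mult: "subst f (p * q) = subst f p * subst f q"
proof (induction p rule: free_alg_induct)
  case (single u c)
  show ?case
  proof (induction q rule: free_alg_induct)
    case (single v d)
    have "subst f (Poly_Mapping.single u c * Poly_Mapping.single v d) =
      Poly_Mapping.single [] c * (Poly_Mapping.single [] d * prod_list (map f u)) *
        prod_list (map f v)"
      using mult_single[of "[]" c "[]" d]
      by (simp add: mult_single subst_single plus_list_def mult.assoc[symmetric])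
    \<comment> \<open>The coefficient \<open>d\<close> of the second factor moves past the image of
      \<open>u\<close>.\<close>
    also have "\<dots> = subst f (Poly_Mapping.single u c) * subst f (Poly_Mapping.single v d)"
      by (subst single_Nil_central) (simp add: subst_single mult.assoc)
    finally show ?case .
  qed (simp_all add: algebra_simps subst_add)
qed (simp_all add: algebra_simps subst_add)

text \<open>The \<open>n\<close>-th power of the augmentation ideal of the free algebra. Congruence
  modulo it plays the role of equality of power series up to order \<open>n\<close>.\<close>

definition order_ge :: "nat \<Rightarrow> ('x, 'k::comm_ring_1) free_alg set"
  where "order_ge n = {p. \<forall>w\<in>Poly_Mapping.keys p. n \<le> length w}"

lemma order_ge_iff: "p \<in> order_ge n \<longleftrightarrow> (\<forall>w. length w < n \<longrightarrow> Poly_Mapping.lookup p w = 0)"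
  by (auto simp: order_ge_def in_keys_iff not_le[symmetric])

lemma order_ge_0 [simp]: "p \<in> order_ge 0"
  by (simp add: order_ge_def)

lemma zero_order_ge [simp]: "0 \<in> order_ge n"
  by (simp add: order_ge_def)

lemma single_order_ge: "n \<le> length w \<Longrightarrow> Poly_Mapping.single w c \<in> order_ge n"
  by (simp add: order_ge_def)

lemma order_ge_mono: "p \<in> order_ge n \<Longrightarrow> m \<le> n \<Longrightarrow> p \<in> order_ge m"
  by (fastforce simp: order_ge_def)

lemma order_ge_add: "p \<in> order_ge n \<Longrightarrow> q \<in> order_ge n \<Longrightarrow> p + q \<in> order_ge n"
  by (simp add: order_ge_iff lookup_add)

lemma order_ge_mult: "p \<in> order_ge m \<Longrightarrow> q \<in> order_ge n \<Longrightarrow> p * q \<in> order_ge (m + n)"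
  using keys_mult[of p q] by (fastforce simp: order_ge_def plus_list_def)

lemma order_ge_mult_left: "q \<in> order_ge n \<Longrightarrow> p * q \<in> order_ge n"
  using order_ge_mult[of p 0] by simp

lemma order_ge_mult_right: "p \<in> order_ge n \<Longrightarrow> p * q \<in> order_ge n"
  using order_ge_mult[of p n q 0] by simp

text \<open>Each letter of a word contributes a factor of order at least 1. This is the continuity
  that a map into power series must have.\<close>

lemma subst_order_ge:
  assumes "\<And>x. f x \<in> order_ge 1" "p \<in> order_ge n"
  shows "subst f p \<in> order_ge n"
proof -
  have *: "prod_list (map f w) \<in> order_ge (length w)" for w
    by (induction w) (use order_ge_mult[OF assms(1)] in auto)
  have "(\<Sum>w\<in>A. Poly_Mapping.single [] (Poly_Mapping.lookup p w) * prod_list (map f w))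
    \<in> order_ge n" if "finite A" "A \<subseteq> Poly_Mapping.keys p" for A
    using that
  proof induction
    case (insert w A)
    then have "n \<le> length w" using assms(2) by (auto simp: order_ge_def)
    with insert show ?case
      by (auto intro!: order_ge_add order_ge_mult_left order_ge_mono[OF *])
  qed simp
  then show ?thesis by (simp add: subst_def)
qed

section \<open>Ideals of the free algebra\<close>

lemma type_algebra_simps [simp]:
  fixes x y :: "'a::ring_1"
  shows "carrier (ring_of_type_algebra :: 'a ring) = UNIV"
    "x \<otimes>\<^bsub>ring_of_type_algebra\<^esub> y = x * y" "x \<oplus>\<^bsub>ring_of_type_algebra\<^esub> y = x + y"
    "\<zero>\<^bsub>ring_of_type_algebra\<^esub> = (0::'a)" "\<one>\<^bsub>ring_of_type_algebra\<^esub> = (1::'a)"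
  by (simp_all add: ring_of_type_algebra_def)

text \<open>Closure under negation comes from multiplication by \<open>-1\<close>.\<close>

lemma ideal_free_ringI:
  fixes I :: "('x, 'k::comm_ring_1) free_alg set"
  assumes "0 \<in> I" "\<And>a b. a \<in> I \<Longrightarrow> b \<in> I \<Longrightarrow> a + b \<in> I"
    and "\<And>a x. a \<in> I \<Longrightarrow> x * a \<in> I" "\<And>a x. a \<in> I \<Longrightarrow> a * x \<in> I"
  shows "ideal I free_ring"
proof (rule idealI[OF ring_free])
  interpret F: ring "free_ring :: ('x, 'k) free_alg ring" by (rule ring_free)
  show "subgroup I (add_monoid free_ring)"
  proof (rule F.add.subgroupI)
    fix a assume a: "a \<in> I"
    have "\<ominus>\<^bsub>free_ring\<^esub> a = - a"
      by (rule F.minus_equality) simp_all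
    then show "\<ominus>\<^bsub>free_ring\<^esub> a \<in> I" using assms(3)[OF a, of "-1"] by simp
  qed (use assms in auto)
qed (use assms in auto)

context
  fixes I :: "('x, 'k::comm_ring_1) free_alg set"
  assumes I: "ideal I free_ring"
begin

lemma ideal_free_zero: "0 \<in> I"
  using additive_subgroup.zero_closed[OF ideal.axioms(1)[OF I]] by simp

lemma ideal_free_add: "a \<in> I \<Longrightarrow> b \<in> I \<Longrightarrow> a + b \<in> I"
  using additive_subgroup.a_closed[OF ideal.axioms(1)[OF I]] by simp

lemma ideal_free_mult_left: "a \<in> I \<Longrightarrow> x * a \<in> I"
  using ideal.I_l_closed[OF I, of a x] by simp

lemma ideal_free_mult_right: "a \<in> I \<Longrightarrow> a * x \<in> I"
  using ideal.I_r_closed[OF I, of a x] by simp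

lemma ideal_free_diff: "a \<in> I \<Longrightarrow> b \<in> I \<Longrightarrow> a - b \<in> I"
  using ideal_free_add[of a "- b"] ideal_free_mult_left[of b "-1"] by simp

lemma coset_free_eq_iff: "I +>\<^bsub>free_ring\<^esub> a = I +>\<^bsub>free_ring\<^esub> b \<longleftrightarrow> a - b \<in> I"
proof
  assume "I +>\<^bsub>free_ring\<^esub> a = I +>\<^bsub>free_ring\<^esub> b"
  moreover have "a \<in> I +>\<^bsub>free_ring\<^esub> a"
    using ideal_free_zero by (force simp: a_r_coset_def')
  ultimately show "a - b \<in> I" by (auto simp: a_r_coset_def')
next
  assume ab: "a - b \<in> I"
  show "I +>\<^bsub>free_ring\<^esub> a = I +>\<^bsub>free_ring\<^esub> b"
  proof (intro equalityI subsetI)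
    fix x assume "x \<in> I +>\<^bsub>free_ring\<^esub> a"
    then obtain h where "h \<in> I" "x = (h + (a - b)) + b" by (auto simp: a_r_coset_def')
    then show "x \<in> I +>\<^bsub>free_ring\<^esub> b"
      using ideal_free_add[OF _ ab] by (force simp: a_r_coset_def')
  next
    fix x assume "x \<in> I +>\<^bsub>free_ring\<^esub> b"
    then obtain h where "h \<in> I" "x = (h - (a - b)) + a" by (auto simp: a_r_coset_def')
    then show "x \<in> I +>\<^bsub>free_ring\<^esub> a"
      using ideal_free_diff[OF _ ab] by (force simp: a_r_coset_def')
  qed
qed

end

lemma genideal_free_ideal: "ideal (genideal free_ring S) free_ring"
  using ring.genideal_ideal[OF ring_free] by simp

lemma genideal_free_self: "S \<subseteq> genideal free_ring S"
  using ring.genideal_self[OF ring_free] by simp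

lemma genideal_free_minimal: "ideal I free_ring \<Longrightarrow> S \<subseteq> I \<Longrightarrow> genideal free_ring S \<subseteq> I"
  using ring.genideal_minimal[OF ring_free] by blast

section \<open>Leading words and reduction\<close>

lemma wf_deglex: "wf deglex"
proof -
  \<comment> \<open>\<open>rec_gen 3 2 1 0\<close> ranks \<open>X1\<close>, \<open>X2\<close>,
    \<open>Y1\<close>, \<open>Y2\<close> in this order, a larger letter having a larger
    rank.\<close>
  have "gen_less \<subseteq> measure (rec_gen 3 2 1 (0::nat))" by (auto simp: gen_less_def)
  then have "wf gen_less" by (rule wf_subset[OF wf_measure])
  then show ?thesis by (simp add: deglex_def wf_lenlex)
qed

lemma irrefl_gen_less: "irrefl gen_less"
  by (auto simp: gen_less_def irrefl_def)

lemma trans_deglex: "trans deglex"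
  unfolding deglex_def by (rule lenlex_transI) (auto simp: gen_less_def trans_def)

lemma total_deglex: "total deglex"
  unfolding deglex_def
proof (rule total_lenlex)
  have "x = y \<or> (x, y) \<in> gen_less \<or> (y, x) \<in> gen_less" for x y
    by (cases x; cases y) (auto simp: gen_less_def)
  then show "total gen_less" unfolding total_on_def by blast
qed

lemma deglex_asym: "(v, w) \<in> deglex \<Longrightarrow> (w, v) \<notin> deglex"
  using wf_deglex by (rule wf_not_sym)

lemma deglex_irrefl [simp]: "(w, w) \<notin> deglex"
  using wf_deglex by (rule wf_irrefl)

lemma deglex_append: "(x, y) \<in> deglex \<Longrightarrow> (u @ x @ v, u @ y @ v) \<in> deglex"
  using lenlex_append1[of x y gen_less v v] irrefl_gen_less
  by (simp add: deglex_def)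

lemma MT_eqI:
  assumes "w \<in> Poly_Mapping.keys p"
    and "\<And>v. v \<in> Poly_Mapping.keys p \<Longrightarrow> v \<noteq> w \<Longrightarrow> (v, w) \<in> deglex"
  shows "MT deglex p = w"
  unfolding MT_def
proof (rule the_equality)
  fix x
  assume x: "x \<in> Poly_Mapping.keys p \<and>
    (\<forall>v\<in>Poly_Mapping.keys p. v \<noteq> x \<longrightarrow> (v, x) \<in> deglex)"
  show "x = w"
  proof (rule ccontr)
    assume "x \<noteq> w"
    with x assms have "(w, x) \<in> deglex" "(x, w) \<in> deglex" by simp_all
    then show False using deglex_asym by metis
  qed
qed (simp add: assms)

text \<open>By totality and transitivity of \<open>deglex\<close>, a finite nonempty set of words
  has a largest element, so the description in \<open>MT\<close> denotes.\<close>

lemma MT_props: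
  assumes "p \<noteq> 0"
  shows "MT deglex p \<in> Poly_Mapping.keys p"
    and "v \<in> Poly_Mapping.keys p \<Longrightarrow> v \<noteq> MT deglex p \<Longrightarrow> (v, MT deglex p) \<in> deglex"
proof -
  have "\<exists>w\<in>A. \<forall>v\<in>A. v \<noteq> w \<longrightarrow> (v, w) \<in> deglex" if "finite A" "A \<noteq> {}" for A
    using that
  proof (induction rule: finite_ne_induct)
    case (insert x A)
    then obtain w where w: "w \<in> A" "\<forall>v\<in>A. v \<noteq> w \<longrightarrow> (v, w) \<in> deglex" by blast
    with \<open>x \<notin> A\<close> have "x \<noteq> w" by blast
    then consider "(x, w) \<in> deglex" | "(w, x) \<in> deglex"
      using total_deglex unfolding total_on_def by blast
    then show ?case
    proof cases
      case 1
      with w show ?thesis by blast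
    next
      case 2
      have "(v, x) \<in> deglex" if "v \<in> A" for v
        using w(2) that 2 transD[OF trans_deglex _ 2] by (cases "v = w") auto
      then show ?thesis by blast
    qed
  qed simp
  moreover have "Poly_Mapping.keys p \<noteq> {}"
    using assms by simp
  ultimately obtain w where w: "w \<in> Poly_Mapping.keys p"
    "\<forall>v\<in>Poly_Mapping.keys p. v \<noteq> w \<longrightarrow> (v, w) \<in> deglex"
    using finite_keys by meson
  then have "MT deglex p = w" by (intro MT_eqI) auto
  with w show "MT deglex p \<in> Poly_Mapping.keys p"
    and "v \<in> Poly_Mapping.keys p \<Longrightarrow> v \<noteq> MT deglex p \<Longrightarrow> (v, MT deglex p) \<in> deglex" by auto
qed

text \<open>Monic with leading word \<open>m\<close>, expressed through the tail
  \<open>r - m\<close>, whose negative is what a reduction step puts in place of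
  \<open>m\<close>.\<close>

definition lead :: "gen list \<Rightarrow> (gen, 'k::comm_ring_1) free_alg \<Rightarrow> bool"
  where "lead m r \<longleftrightarrow> (\<forall>v\<in>Poly_Mapping.keys (r - wd m). (v, m) \<in> deglex)"

lemma lead_MT:
  assumes "lead m r"
  shows "MT deglex r = m" and "Poly_Mapping.lookup r m = 1" and "r \<noteq> 0"
proof -
  have "m \<notin> Poly_Mapping.keys (r - wd m)"
    using assms unfolding lead_def by auto
  then show *: "Poly_Mapping.lookup r m = 1"
    by (simp add: in_keys_iff lookup_minus)
  then show "r \<noteq> 0" by auto
  show "MT deglex r = m"
  proof (rule MT_eqI)
    fix v assume "v \<in> Poly_Mapping.keys r" "v \<noteq> m"
    then have "v \<in> Poly_Mapping.keys (r - wd m)"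
      by (simp add: in_keys_iff lookup_minus lookup_single)
    then show "(v, m) \<in> deglex" using assms by (simp add: lead_def)
  qed (simp add: in_keys_iff *)
qed

text \<open>An inclusion only, since \<open>c\<close> and \<open>d\<close> may annihilate
  coefficients of \<open>s\<close>.\<close>

lemma keys_context:
  "Poly_Mapping.keys (Poly_Mapping.single u c * s * Poly_Mapping.single v d)
    \<subseteq> (\<lambda>w. u @ w @ v) ` Poly_Mapping.keys s"
proof
  fix x assume "x \<in> Poly_Mapping.keys (Poly_Mapping.single u c * s * Poly_Mapping.single v d)"
  then obtain a b where "a \<in> Poly_Mapping.keys (Poly_Mapping.single u c * s)"
    "b \<in> Poly_Mapping.keys (Poly_Mapping.single v d)" "x = a + b"
    using keys_mult by blast
  moreover from this(1) obtain a' b' where "a' \<in> Poly_Mapping.keys (Poly_Mapping.single u c)"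
    "b' \<in> Poly_Mapping.keys s" "a = a' + b'"
    using keys_mult by blast
  ultimately show "x \<in> (\<lambda>w. u @ w @ v) ` Poly_Mapping.keys s"
    by (auto simp: plus_list_def split: if_splits)
qed

lemma lead_context:
  assumes "lead m r"
  shows "lead (u @ m @ v) (wd u * r * wd v)"
proof -
  have "wd u * r * wd v - wd (u @ m @ v) = wd u * (r - wd m) * wd v"
    by (simp add: algebra_simps mult_single plus_list_def)
  moreover have "(x, u @ m @ v) \<in> deglex"
    if "x \<in> Poly_Mapping.keys (wd u * (r - wd m) * wd v)" for x
    using that keys_context[of u 1 "r - wd m" v 1] assms deglex_append
    by (fastforce simp: lead_def)
  ultimately show ?thesis by (simp add: lead_def)
qed


section \<open>Reduction to normal words and a criterion for Groebner-Shirshov bases\<close>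

definition below :: "gen list \<Rightarrow> gen list set"
  where "below w = {v. v = w \<or> (v, w) \<in> deglex}"

lemma below_trans: "(v, w) \<in> deglex \<Longrightarrow> below v \<subseteq> below w"
  by (auto simp: below_def intro: transD[OF trans_deglex, where y = v])

text \<open>Rewriting a factor \<open>m\<close> by means of \<open>r\<close> terminates because
  \<open>deglex\<close> is well-founded. The bound through \<open>below\<close> ensures later that
  reducing a tail cannot produce the leading word again.\<close>

lemma reduction:
  fixes K :: "(gen, 'k::comm_ring_1) free_alg set" and nf :: "gen list \<Rightarrow> bool"
    and p :: "(gen, 'k) free_alg"
  assumes K: "ideal K free_ring"
    and red: "\<And>w. \<not> nf w \<Longrightarrow> \<exists>u m v r. w = u @ m @ v \<and> r \<in> K \<and> lead m r"
  shows "\<exists>q. p - q \<in> K \<and>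
    (\<forall>v\<in>Poly_Mapping.keys q. nf v \<and> (\<exists>w\<in>Poly_Mapping.keys p. v \<in> below w))"
proof -
  \<comment> \<open>\<open>D S\<close> consists of the polynomials congruent modulo \<open>K\<close>
    to a combination of normal words from \<open>S\<close>. It is closed under sums, so induction
    over single words suffices.\<close>
  define D where "D S = {p. \<exists>q. p - q \<in> K \<and> Poly_Mapping.keys q \<subseteq> Collect nf \<inter> S}"
    for S :: "gen list set"
  have D_add: "a + b \<in> D S" if "a \<in> D S" "b \<in> D S" for a b S
  proof -
    from that obtain q q' where q: "a - q \<in> K" "b - q' \<in> K"
      "Poly_Mapping.keys q \<subseteq> Collect nf \<inter> S" "Poly_Mapping.keys q' \<subseteq> Collect nf \<inter> S"
      unfolding D_def by blast
    then have "(a + b) - (q + q') \<in> K"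
      using ideal_free_add[OF K q(1,2)] by (simp add: algebra_simps)
    moreover have "Poly_Mapping.keys (q + q') \<subseteq> Collect nf \<inter> S"
      using keys_add[of q q'] q(3,4) by blast
    ultimately show ?thesis unfolding D_def by blast
  qed
  have D_zero: "0 \<in> D S" for S
    using ideal_free_zero[OF K] by (auto simp: D_def intro!: exI[of _ 0])
  have D_mono: "a \<in> D T" if "a \<in> D S" "S \<subseteq> T" for a S T
    using that unfolding D_def by blast
  have D_sum: "a \<in> D S"
    if single: "\<And>w c. w \<in> Poly_Mapping.keys a \<Longrightarrow> Poly_Mapping.single w c \<in> D S" for a S
  proof -
    have "(\<Sum>w\<in>A. Poly_Mapping.single w (Poly_Mapping.lookup a w)) \<in> D S"
      if "finite A" "A \<subseteq> Poly_Mapping.keys a" for A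
      using that
    proof induction
      case (insert w A)
      with single show ?case by (simp add: D_add)
    qed (simp add: D_zero)
    from this[OF finite_keys order_refl] show ?thesis by (subst free_alg_sum)
  qed
  have D_single: "Poly_Mapping.single w c \<in> D (below w)" for w c
    using wf_deglex
  proof (induction w arbitrary: c rule: wf_induct_rule)
    case (less w)
    show ?case
    proof (cases "nf w")
      case True
      then show ?thesis using ideal_free_zero[OF K]
        by (auto simp: D_def below_def split: if_splits
            intro!: exI[of _ "Poly_Mapping.single w c"])
    next
      case False
      with red obtain u m v r where w: "w = u @ m @ v" and r: "r \<in> K" "lead m r" by metis
      \<comment> \<open>One rewriting step: subtracting \<open>c u r v\<close>, an element of
        \<open>K\<close>, from \<open>c w\<close> leaves \<open>?s\<close>, whose words are all
        smaller than \<open>w\<close>.\<close>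
      let ?s = "Poly_Mapping.single u (- c) * (r - wd m) * wd v"
      have "?s \<in> D (below w)"
      proof (rule D_sum)
        fix w' d assume "w' \<in> Poly_Mapping.keys ?s"
        then obtain x where "w' = u @ x @ v" "x \<in> Poly_Mapping.keys (r - wd m)"
          using keys_context[of u "- c" "r - wd m" v 1] by blast
        then have w': "(w', w) \<in> deglex"
          using r(2) deglex_append by (simp add: lead_def w)
        show "Poly_Mapping.single w' d \<in> D (below w)"
          by (rule D_mono[OF less[OF w'] below_trans[OF w']])
      qed
      then obtain q where q: "?s - q \<in> K" "Poly_Mapping.keys q \<subseteq> Collect nf \<inter> below w"
        unfolding D_def by blast
      have "Poly_Mapping.single w c = Poly_Mapping.single u c * r * wd v + ?s"
        by (simp add: w algebra_simps mult_single plus_list_def single_uminus)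
      then have *: "Poly_Mapping.single w c - q = Poly_Mapping.single u c * r * wd v + (?s - q)"
        by simp
      have "Poly_Mapping.single u c * r * wd v \<in> K"
        using r(1) by (intro ideal_free_mult_left[OF K] ideal_free_mult_right[OF K])
      then have "Poly_Mapping.single w c - q \<in> K"
        unfolding * using q(1) by (rule ideal_free_add[OF K])
      with q(2) show ?thesis unfolding D_def by blast
    qed
  qed
  have "p \<in> D (\<Union>w\<in>Poly_Mapping.keys p. below w)"
    by (rule D_sum) (rule D_mono[OF D_single], blast)
  then obtain q where "p - q \<in> K"
    "Poly_Mapping.keys q \<subseteq> Collect nf \<inter> (\<Union>w\<in>Poly_Mapping.keys p. below w)"
    unfolding D_def by blast
  then show ?thesis by (intro exI[of _ q]) auto
qed

text \<open>Independence of the normal words modulo the ideal replaces the check of overlaps: if an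
  ideal element had a normal leading word, reducing its tail would give a nonzero combination of
  normal words in the ideal.\<close>

lemma GS_basis_deglexI:
  fixes R :: "(gen, 'k::comm_ring_1) free_alg set" and nf :: "gen list \<Rightarrow> bool"
  assumes lead: "\<And>r. r \<in> R \<Longrightarrow> \<exists>m. lead m r"
    and red: "\<And>w. \<not> nf w \<Longrightarrow> \<exists>u m v r. w = u @ m @ v \<and> r \<in> R \<and> lead m r"
    and indep: "\<And>q. q \<in> genideal free_ring R \<Longrightarrow>
      (\<And>w. w \<in> Poly_Mapping.keys q \<Longrightarrow> nf w) \<Longrightarrow> q = 0"
  shows "GS_basis deglex R"
proof -
  let ?K = "genideal free_ring R"
  have K: "ideal ?K free_ring" by (rule genideal_free_ideal)
  have redK: "\<exists>u m v r. w = u @ m @ v \<and> r \<in> ?K \<and> lead m r" if "\<not> nf w" for w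
    using red[OF that] genideal_free_self by blast
  have "\<exists>m\<in>MT deglex ` R. \<exists>u v. MT deglex p = u @ m @ v" if p: "p \<in> ?K" "p \<noteq> 0" for p
  proof (cases "nf (MT deglex p)")
    case False
    with red obtain u m v r where "MT deglex p = u @ m @ v" "r \<in> R" "lead m r" by metis
    moreover from this have "m = MT deglex r" by (simp add: lead_MT)
    ultimately show ?thesis by blast
  next
    case True
    define w c where "w = MT deglex p" and "c = Poly_Mapping.lookup p w"
    have c: "c \<noteq> 0" using MT_props(1)[OF p(2)] by (simp add: c_def w_def in_keys_iff)
    \<comment> \<open>Only the tail is reduced, so the result cannot cancel the leading term
      \<open>c w\<close>.\<close>
    let ?p = "p - Poly_Mapping.single w c"
    obtain q where q: "?p - q \<in> ?K"
      "\<forall>v\<in>Poly_Mapping.keys q. nf v \<and> (\<exists>w\<in>Poly_Mapping.keys ?p. v \<in> below w)"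
      using reduction[where nf = nf and p = ?p, OF K redK] by blast
    have small: "(v, w) \<in> deglex" if "v \<in> Poly_Mapping.keys ?p" for v
    proof -
      have "Poly_Mapping.lookup ?p w = 0" by (simp add: lookup_minus c_def)
      with that have "v \<noteq> w" by (metis in_keys_iff)
      with that have "v \<in> Poly_Mapping.keys p"
        by (simp add: in_keys_iff lookup_minus lookup_single)
      with \<open>v \<noteq> w\<close> show ?thesis using MT_props(2)[OF p(2)] by (simp add: w_def)
    qed
    have "w \<notin> Poly_Mapping.keys q"
    proof
      assume "w \<in> Poly_Mapping.keys q"
      then obtain v where "v \<in> Poly_Mapping.keys ?p" "w \<in> below v" using q(2) by blast
      then have "w = v \<or> (w, v) \<in> deglex" "(v, w) \<in> deglex"
        using small by (simp_all add: below_def)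
      then show False using deglex_asym deglex_irrefl by metis
    qed
    then have lw: "Poly_Mapping.lookup (Poly_Mapping.single w c + q) w = c"
      by (simp add: lookup_add in_keys_iff)
    have "p - (?p - q) \<in> ?K" using p(1) q(1) by (rule ideal_free_diff[OF K])
    then have "Poly_Mapping.single w c + q \<in> ?K" by (simp add: algebra_simps)
    moreover have "nf x" if "x \<in> Poly_Mapping.keys (Poly_Mapping.single w c + q)" for x
    proof -
      have "x \<in> insert w (Poly_Mapping.keys q)"
        using subsetD[OF keys_add that] by (auto split: if_splits)
      moreover have "nf w" using True by (simp add: w_def)
      ultimately show ?thesis using q(2) by blast
    qed
    ultimately have "Poly_Mapping.single w c + q = 0" by (rule indep)
    with lw c show ?thesis by simp
  qed
  then have "x \<in> {u @ m @ v | u m v. m \<in> MT deglex ` R}" if "x \<in> MT deglex ` (?K - {0})" for x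
    using that by blast
  then have "MT deglex ` (?K - {0}) \<subseteq> {u @ m @ v | u m v. m \<in> MT deglex ` R}" ..
  \<comment> \<open>Leading coefficients equal to 1 survive in any context, even if
    \<open>'k\<close> has zero divisors.\<close>
  moreover have "u @ MT deglex r @ v \<in> MT deglex ` (?K - {0})" if r: "r \<in> R" for r u v
  proof -
    obtain m where m: "lead m r" using lead[OF r] by blast
    have "r \<in> ?K" using r genideal_free_self by blast
    then have "wd u * r * wd v \<in> ?K"
      by (intro ideal_free_mult_left[OF K] ideal_free_mult_right[OF K])
    moreover have "wd u * r * wd v \<noteq> 0" "MT deglex (wd u * r * wd v) = u @ MT deglex r @ v"
      using lead_MT[OF lead_context[OF m, of u v]] lead_MT(1)[OF m] by simp_all
    ultimately show ?thesis by (metis DiffI imageI singletonD)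
  qed
  then have "{u @ m @ v | u m v. m \<in> MT deglex ` R} \<subseteq> MT deglex ` (?K - {0})"
    by blast
  moreover have "monic deglex r" if r: "r \<in> R" for r
  proof -
    obtain m where "lead m r" using lead[OF r] by blast
    then show ?thesis by (simp add: monic_def lead_MT)
  qed
  ultimately show ?thesis unfolding GS_basis_def by (intro conjI ballI subset_antisym)
qed

section \<open>The embedding into power series\<close>

text \<open>Truncations of the Catalan series keep everything inside the free algebra: the relations
  then hold up to order \<open>n\<close> instead of exactly.\<close>

fun catalan :: "nat \<Rightarrow> ('x, 'k::comm_ring_1) free_alg \<Rightarrow> ('x, 'k) free_alg" where
  "catalan 0 t = 0"
| "catalan (Suc n) t = t + catalan n t * catalan n t"

fun ser :: "nat \<Rightarrow> gen \<Rightarrow> (gen, 'k::comm_ring_1) free_alg" where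
  "ser n X1 = gvar X1"
| "ser n X2 = gvar X2"
| "ser n Y1 = catalan n (gvar X1 * gvar X2)"
| "ser n Y2 = catalan n (gvar X2 * gvar X1)"

lemma gvar_order_ge: "gvar x \<in> order_ge 1"
  by (simp add: gvar_def single_order_ge)

lemma gvar_mult_order_ge: "gvar x * gvar y \<in> order_ge 2"
  using order_ge_mult[OF gvar_order_ge gvar_order_ge] by (simp flip: one_add_one)

lemma catalan_order_ge: "t \<in> order_ge d \<Longrightarrow> catalan n t \<in> order_ge d"
  by (induction n) (auto intro: order_ge_add order_ge_mult_left)

text \<open>The iteration is a contraction: in \<open>a a - b b = a (a - b) + (a - b) b\<close> the
  factors \<open>a\<close> and \<open>b\<close> have order at least 1, so each step gains one
  order.\<close>

lemma catalan_Suc_diff_order_ge: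
  assumes t: "t \<in> order_ge 1"
  shows "catalan (Suc n) t - catalan n t \<in> order_ge (Suc n)"
proof (induction n)
  case (Suc n)
  let ?a = "catalan (Suc n) t" and ?b = "catalan n t"
  have "catalan (Suc (Suc n)) t - catalan (Suc n) t = ?a * ?a - ?b * ?b"
    by (simp add: algebra_simps)
  also have "\<dots> = ?a * (?a - ?b) + (?a - ?b) * ?b"
    by (simp only: algebra_simps)
  also have "\<dots> \<in> order_ge (Suc (Suc n))"
    using order_ge_mult[OF catalan_order_ge[OF t] Suc, of "Suc n"]
      order_ge_mult[OF Suc catalan_order_ge[OF t], of n]
    by (intro order_ge_add) simp_all
  finally show ?case .
qed (use t in simp)

text \<open>An instance of \<open>a (b a)^k = (a b)^k a\<close>, since \<open>catalan n\<close> is a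
  polynomial in its argument. Hence \<open>r3\<close> and \<open>r4\<close> are killed exactly at
  every truncation.\<close>

lemma catalan_intertwine: "a * catalan n (b * a) = catalan n (a * b) * a"
proof (induction n)
  case (Suc n)
  have "a * (catalan n (b * a) * catalan n (b * a)) = catalan n (a * b) * catalan n (a * b) * a"
    by (metis Suc mult.assoc)
  then show ?case by (simp add: distrib_left distrib_right mult.assoc)
qed simp

lemma ser_order_ge: "ser n x \<in> order_ge 1"
  using gvar_order_ge[of x] order_ge_mono[OF catalan_order_ge[OF gvar_mult_order_ge], of 1]
  by (cases x) simp_all

text \<open>The image of \<open>r1\<close> is the error
  \<open>catalan (Suc n) t - catalan n t\<close> at \<open>t = x1 x2\<close>; for \<open>r2\<close>
  take \<open>t = x2 x1\<close>.\<close>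

lemma subst_ser_r12: "subst (ser n) r1 \<in> order_ge n" "subst (ser n) r2 \<in> order_ge n"
proof -
  have *: "gvar x * gvar y + catalan n (gvar x * gvar y) * catalan n (gvar x * gvar y)
    - catalan n (gvar x * gvar y) \<in> order_ge n" for x y :: gen
    using order_ge_mono[OF catalan_Suc_diff_order_ge[OF order_ge_mono[OF gvar_mult_order_ge]],
        where m = n and n1 = n] by simp
  show "subst (ser n) r1 \<in> order_ge n" "subst (ser n) r2 \<in> order_ge n"
    by (simp_all add: r1_def r2_def subst_add subst_diff subst_mult power2_eq_square *)
qed

lemma subst_ser_r34: "subst (ser n) r3 = 0" "subst (ser n) r4 = 0"
  by (simp_all add: r3_def r4_def subst_diff subst_mult catalan_intertwine)

lemma ideal_subst_vimage:
  assumes "\<And>x. f x \<in> order_ge 1"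
  shows "ideal {p. subst f p \<in> order_ge n} free_ring"
  by (rule ideal_free_ringI)
     (auto simp: subst_add subst_mult intro: order_ge_add order_ge_mult_left order_ge_mult_right)

lemma subst_ser_genideal:
  assumes "p \<in> genideal free_ring {r1, r2, r3, r4}"
  shows "subst (ser n) p \<in> order_ge n"
proof -
  have "ideal {p. subst (ser n) p \<in> order_ge n} free_ring"
    by (rule ideal_subst_vimage) (rule ser_order_ge)
  then have "genideal free_ring {r1, r2, r3, r4} \<subseteq> {p. subst (ser n) p \<in> order_ge n}"
    by (rule genideal_free_minimal) (simp add: subst_ser_r12 subst_ser_r34)
  with assms show ?thesis by blast
qed

section \<open>Lowest terms and the independence of normal words\<close>

fun low :: "gen \<Rightarrow> gen list" where
  "low X1 = [X1]"
| "low X2 = [X2]"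
| "low Y1 = [X1, X2]"
| "low Y2 = [X2, X1]"

text \<open>The level is \<open>Suc n\<close> because \<open>catalan 0 t = 0\<close> does not yet
  contain the lowest term \<open>t\<close>. Beyond \<open>t\<close> there is only a square, of order
  at least 4.\<close>

lemma ser_low: "ser (Suc n) x - wd (low x) \<in> order_ge (Suc (length (low x)))"
proof -
  have *: "catalan n (gvar x * gvar y) * catalan n (gvar x * gvar y) \<in> order_ge 3" for x y :: gen
    using order_ge_mult[OF catalan_order_ge catalan_order_ge, OF gvar_mult_order_ge gvar_mult_order_ge]
    by (rule order_ge_mono) simp
  show ?thesis
    using * by (cases x) (simp_all add: gvar_def mult_single plus_list_def eval_nat_numeral)
qed

text \<open>Lowest terms multiply, by \<open>f P - w v = (f - w) P + w (P - v)\<close>: in each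
  summand the difference supplies the extra degree.\<close>

lemma prod_list_ser_low:
  fixes w :: "gen list"
  defines "s \<equiv> concat (map low w)"
  shows "prod_list (map (ser (Suc n)) w) - (wd s :: (gen, 'k::comm_ring_1) free_alg)
    \<in> order_ge (Suc (length s))"
  unfolding s_def
proof (induction w)
  case (Cons x w)
  let ?f = "ser (Suc n) x :: (gen, 'k) free_alg"
  let ?P = "prod_list (map (ser (Suc n)) w) :: (gen, 'k) free_alg"
  let ?s = "concat (map low w)"
  let ?w = "wd (low x) :: (gen, 'k) free_alg" and ?v = "wd ?s :: (gen, 'k) free_alg"
  have "(?P - ?v) + ?v \<in> order_ge (length ?s)"
    by (rule order_ge_add[OF order_ge_mono[OF Cons] single_order_ge]) simp_all
  then have P: "?P \<in> order_ge (length ?s)" by simp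
  have "?f * ?P - ?w * ?v = (?f - ?w) * ?P + ?w * (?P - ?v)"
    by (simp add: algebra_simps)
  also have "\<dots> \<in> order_ge (Suc (length (low x) + length ?s))"
    using order_ge_mult[OF ser_low[of n x] P]
      order_ge_mult[OF single_order_ge[OF order_refl, of "low x" 1] Cons]
    by (intro order_ge_add) simp_all
  finally show ?case by (simp add: mult_single plus_list_def)
qed simp

text \<open>A test on adjacent letters is enough, as the leading words of the four relations have
  length two.\<close>

fun nf :: "gen list \<Rightarrow> bool" where
  "nf (a # b # w) \<longleftrightarrow> (a, b) \<notin> {(X1, X2), (X2, X1), (X1, Y2), (X2, Y1)} \<and> nf (b # w)"
| "nf _ \<longleftrightarrow> True"

lemma not_nf_factor:
  assumes "\<not> nf w"
  shows "\<exists>u v. \<exists>m\<in>{[X1, X2], [X2, X1], [X1, Y2], [X2, Y1]}. w = u @ m @ v"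
  using assms
proof (induction w rule: nf.induct)
  case (1 a b w)
  show ?case
  proof (cases "nf (b # w)")
    case True
    with 1(2) have "[a, b] \<in> {[X1, X2], [X2, X1], [X1, Y2], [X2, Y1]}" by auto
    moreover have "a # b # w = [] @ [a, b] @ w" by simp
    ultimately show ?thesis by blast
  next
    case False
    with 1(1) obtain u v m where "m \<in> {[X1, X2], [X2, X1], [X1, Y2], [X2, Y1]}"
      "b # w = u @ m @ v" by blast
    moreover from this(2) have "a # b # w = (a # u) @ m @ v" by simp
    ultimately show ?thesis by blast
  qed
qed auto

text \<open>The letters \<open>x\<^sub>1x\<^sub>2\<close> at the start of the image of a normal word can only come from \<open>y\<^sub>1\<close>,
  since there \<open>x\<^sub>1\<close> is followed by neither \<open>x\<^sub>2\<close> nor \<open>y\<^sub>2\<close>; so the word is decoded from the left.\<close>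

fun first_letter :: "gen list \<Rightarrow> gen" where
  "first_letter (X1 # X2 # w) = Y1"
| "first_letter (X2 # X1 # w) = Y2"
| "first_letter w = hd w"

lemma first_letter_low: "nf (a # w) \<Longrightarrow> first_letter (concat (map low (a # w))) = a"
  by (cases w; cases a; cases "hd w") simp_all

lemma low_inj:
  "nf v \<Longrightarrow> nf w \<Longrightarrow> concat (map low v) = concat (map low w) \<Longrightarrow> v = w"
proof (induction v arbitrary: w)
  case Nil
  then show ?case by (cases w; cases "hd w") simp_all
next
  case (Cons a v)
  then obtain b u where w: "w = b # u" by (cases w; cases a) auto
  have "nf v" "nf u" using Cons.prems w by (cases v; cases u; simp)+
  moreover have "a = b"
    using first_letter_low[OF Cons.prems(1)] first_letter_low[of b u] Cons.prems w by metis
  ultimately show ?case using Cons.IH[of u] Cons.prems(3) w by simp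
qed

text \<open>Take a word \<open>z\<close> of \<open>q\<close> whose lowest term is shortest. By
  injectivity of \<open>low\<close> on normal words nothing cancels that term in the image, so its
  coefficient there is that of \<open>z\<close> in \<open>q\<close>; the order bound forces it to be
  0.\<close>

lemma nf_faithful:
  fixes q :: "(gen, 'k::comm_ring_1) free_alg"
  assumes nf: "\<And>w. w \<in> Poly_Mapping.keys q \<Longrightarrow> nf w"
    and ord: "\<And>n. subst (ser n) q \<in> order_ge n"
  shows "q = 0"
proof (rule ccontr)
  assume "q \<noteq> 0"
  let ?K = "Poly_Mapping.keys q" and ?s = "\<lambda>w. concat (map low w)"
  obtain z where z: "z \<in> ?K" "\<And>w. w \<in> ?K \<Longrightarrow> length (?s z) \<le> length (?s w)"
    using arg_min_if_finite(1)[of ?K "\<lambda>w. length (?s w)"]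
      arg_min_least[of ?K _ "\<lambda>w. length (?s w)"] \<open>q \<noteq> 0\<close>
    by (metis finite_keys keys_eq_empty)
  \<comment> \<open>Order at least \<open>Suc ?n\<close> is what makes coefficients at words of
    length \<open>?n\<close> vanish.\<close>
  let ?n = "length (?s z)"
  \<comment> \<open>The image of any other word of \<open>q\<close> has a lowest term of length at
    least \<open>?n\<close> that differs from \<open>?s z\<close> by \<open>low_inj\<close>, so it
    contributes nothing at \<open>?s z\<close>.\<close>
  have *: "Poly_Mapping.lookup (prod_list (map (ser (Suc ?n)) w)) (?s z)
    = (if w = z then 1 else (0::'k))" if "w \<in> ?K" for w
  proof -
    have "Poly_Mapping.lookup (prod_list (map (ser (Suc ?n)) w) - wd (?s w)) (?s z) = (0::'k)"
      using prod_list_ser_low[where n = ?n and w = w and 'k = 'k] z(2)[OF that]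
      by (simp add: order_ge_iff)
    moreover have "?s w = ?s z \<longleftrightarrow> w = z" using low_inj nf that z(1) by blast
    ultimately show ?thesis by (simp add: lookup_minus lookup_single when_def)
  qed
  have "Poly_Mapping.lookup (subst (ser (Suc ?n)) q) (?s z) =
    (\<Sum>w\<in>?K. Poly_Mapping.lookup q w * (if w = z then 1 else 0))"
    unfolding subst_def lookup_sum lookup_single_Nil_mult
    by (intro sum.cong) (simp_all add: *)
  also have "\<dots> = Poly_Mapping.lookup q z"
    using z(1) by (simp add: if_distrib[where f = "(*) _"] sum.delta' cong: if_cong)
  finally have "Poly_Mapping.lookup q z = 0"
    using ord[of "Suc ?n"] by (simp add: order_ge_iff)
  with z(1) show False by (simp add: in_keys_iff)
qed

section \<open>The Groebner-Shirshov property and residual nilpotence\<close>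

lemma lead_relations:
  "lead [X1, X2] (r1 :: (gen, 'k::comm_ring_1) free_alg)" "lead [X2, X1] (r2 :: (gen, 'k) free_alg)"
  "lead [X1, Y2] (r3 :: (gen, 'k) free_alg)" "lead [X2, Y1] (r4 :: (gen, 'k) free_alg)"
proof -
  have keys: "(w, m) \<in> deglex" if "w \<in> Poly_Mapping.keys (wd a - wd b :: (gen, 'k) free_alg)"
    "(a, m) \<in> deglex" "(b, m) \<in> deglex" for a b m w
    using that by (auto simp: in_keys_iff lookup_minus lookup_single when_def split: if_splits)
  \<comment> \<open>\<open>r1\<close> and \<open>r2\<close> have the shape
    \<open>x y + z^2 - z\<close>, while \<open>r3\<close> and \<open>r4\<close> have the shape
    \<open>x y - z x\<close>. In all four \<open>z < x\<close>, which puts the other words below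
    \<open>x y\<close>.\<close>
  have r12: "lead [x, y] (gvar x * gvar y + (gvar z)\<^sup>2 - gvar z :: (gen, 'k) free_alg)"
    if "(z, x) \<in> gen_less" for x y z
    unfolding lead_def
  proof
    fix v
    assume "v \<in> Poly_Mapping.keys (gvar x * gvar y + (gvar z)\<^sup>2 - gvar z - wd [x, y] :: (gen, 'k) free_alg)"
    then have "v \<in> Poly_Mapping.keys (wd [z, z] - wd [z] :: (gen, 'k) free_alg)"
      by (simp add: gvar_def power2_eq_square mult_single plus_list_def algebra_simps)
    then show "(v, [x, y]) \<in> deglex"
      by (rule keys) (use that in \<open>simp_all add: deglex_def Cons_lenlex_iff\<close>)
  qed
  have r34: "lead [x, y] (gvar x * gvar y - gvar z * gvar x :: (gen, 'k) free_alg)"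
    if "(z, x) \<in> gen_less" for x y z
    unfolding lead_def
  proof
    fix v
    assume "v \<in> Poly_Mapping.keys (gvar x * gvar y - gvar z * gvar x - wd [x, y] :: (gen, 'k) free_alg)"
    then have "v = [z, x]"
      by (simp add: gvar_def mult_single plus_list_def)
    then show "(v, [x, y]) \<in> deglex"
      using that by (simp add: deglex_def Cons_lenlex_iff)
  qed
  show "lead [X1, X2] (r1 :: (gen, 'k) free_alg)" "lead [X2, X1] (r2 :: (gen, 'k) free_alg)"
    "lead [X1, Y2] (r3 :: (gen, 'k) free_alg)" "lead [X2, Y1] (r4 :: (gen, 'k) free_alg)"
    by (simp_all add: r1_def r2_def r3_def r4_def r12 r34 gen_less_def)
qed

lemma not_nf_relation:
  assumes "\<not> nf w"
  shows "\<exists>u m v. \<exists>r\<in>{r1, r2, r3, r4}. w = u @ m @ v \<and> lead m r"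
proof -
  obtain u m v where "m \<in> {[X1, X2], [X2, X1], [X1, Y2], [X2, Y1]}" and w: "w = u @ m @ v"
    using not_nf_factor[OF assms] by blast
  then have "\<exists>r\<in>{r1, r2, r3, r4}. lead m r"
    using lead_relations by blast
  with w show ?thesis by blast
qed

lemma GS_basis_relations: "GS_basis deglex {r1, r2, r3, r4}"
proof (rule GS_basis_deglexI[where nf = nf])
  show "\<exists>m. lead m r" if "r \<in> {r1, r2, r3, r4}" for r
    using that lead_relations by blast
  show "\<exists>u m v r. w = u @ m @ v \<and> r \<in> {r1, r2, r3, r4} \<and> lead m r" if "\<not> nf w" for w
    using not_nf_relation[OF that] by blast
  show "q = 0" if "q \<in> genideal free_ring {r1, r2, r3, r4}"
    "\<And>w. w \<in> Poly_Mapping.keys q \<Longrightarrow> nf w" for q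
    using that(2) subst_ser_genideal[OF that(1)] by (rule nf_faithful)
qed

text \<open>Let \<open>q\<close> be a normal form of \<open>f\<close>. As \<open>q - g\<close> lies
  in \<open>K\<close> and \<open>g\<close> has order at least \<open>n\<close>, so does the image of
  \<open>q\<close> at level \<open>n\<close>. This holds for all \<open>n\<close>, whence
  \<open>q = 0\<close> by \<open>nf_faithful\<close>.\<close>

lemma residually_nilpotent:
  fixes f :: "(gen, 'k::comm_ring_1) free_alg"
  defines "K \<equiv> genideal free_ring {r1, r2, r3, r4}"
  assumes "\<And>n. n \<ge> 1 \<Longrightarrow> \<exists>g\<in>order_ge n. f - g \<in> K"
  shows "f \<in> K"
proof -
  have K: "ideal K free_ring" unfolding K_def by (rule genideal_free_ideal)
  have red: "\<exists>u m v r. w = u @ m @ v \<and> r \<in> K \<and> lead m r" if w: "\<not> nf w" for w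
  proof -
    obtain u m v and r :: "(gen, 'k) free_alg"
      where "r \<in> {r1, r2, r3, r4}" "w = u @ m @ v" "lead m r"
      using not_nf_relation[OF w] by blast
    moreover from this(1) have "r \<in> K" unfolding K_def by (rule subsetD[OF genideal_free_self])
    ultimately show ?thesis by blast
  qed
  obtain q where q: "f - q \<in> K" "\<forall>v\<in>Poly_Mapping.keys q. nf v"
    using reduction[where nf = nf and p = f, OF K red] by blast
  have "subst (ser n) q \<in> order_ge n" for n
  proof (cases "n \<ge> 1")
    case True
    then obtain g where g: "g \<in> order_ge n" "f - g \<in> K" using assms(2) by blast
    have "(f - g) - (f - q) \<in> K" using g(2) q(1) by (rule ideal_free_diff[OF K])
    then have "subst (ser n) (q - g) \<in> order_ge n"
      unfolding K_def by (intro subst_ser_genideal) simp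
    moreover have "subst (ser n) g \<in> order_ge n" by (rule subst_order_ge[OF ser_order_ge g(1)])
    ultimately have "subst (ser n) (q - g) + subst (ser n) g \<in> order_ge n" by (rule order_ge_add)
    then show ?thesis by (simp add: subst_diff)
  next
    case False
    then show ?thesis by (simp add: not_le)
  qed
  with q(2) have "q = 0" by (intro nf_faithful) simp_all
  with q(1) show ?thesis by simp
qed

section \<open>The algebras \<open>B\<close> and \<open>A\<close>\<close>

text \<open>Stated for arbitrary rings, as \<open>algB\<close> is not commutative; associativity
  allows a factor to be split off a power of an ideal on either side.\<close>

lemma (in ring) monoid_ideals_set: "Group.monoid (ideals_set R)"
proof (rule monoidI)
  fix I assume "I \<in> carrier (ideals_set R)"
  then have I: "ideal I R" by (simp add: ideals_set_def)
  have "s \<in> I" if "s \<in> carrier R \<cdot> I" for s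
    using that by induction
      (auto intro: ideal.I_l_closed[OF I] additive_subgroup.a_closed[OF ideal.axioms(1)[OF I]])
  moreover have "s \<in> carrier R \<cdot> I" if "s \<in> I" for s
    using ideal_prod.prod[OF one_closed that, of R] ideal.Icarr[OF I that] by simp
  ultimately show "\<one>\<^bsub>ideals_set R\<^esub> \<otimes>\<^bsub>ideals_set R\<^esub> I = I"
    by (auto simp: ideals_set_def)
qed (auto simp: ideals_set_def ideal_prod_is_ideal oneideal ideal_prod_one ideal_prod_assoc)

abbreviation J12 :: "(gen, 'k::comm_ring_1) free_alg set"
  where "J12 \<equiv> genideal free_ring {r1, r2}"

abbreviation toB :: "(gen, 'k::comm_ring_1) free_alg \<Rightarrow> (gen, 'k) free_alg set"
  where "toB f \<equiv> J12 +>\<^bsub>free_ring\<^esub> f"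

lemma ring_algB: "ring algB"
  unfolding algB_def by (rule ideal.quotient_is_ring[OF genideal_free_ideal])

lemma toB_hom: "toB \<in> ring_hom free_ring algB"
  unfolding algB_def by (rule ideal.rcos_ring_hom[OF genideal_free_ideal])

lemma toB_mult: "toB f \<otimes>\<^bsub>algB\<^esub> toB g = toB (f * g)"
  and toB_add: "toB f \<oplus>\<^bsub>algB\<^esub> toB g = toB (f + g)"
  and toB_one: "\<one>\<^bsub>algB\<^esub> = toB 1"
  using ring_hom_mult[OF toB_hom, of f g] ring_hom_add[OF toB_hom, of f g]
    ring_hom_one[OF toB_hom, symmetric] by simp_all

lemma toB_zero: "\<zero>\<^bsub>algB\<^esub> = toB 0"
  using ring_hom_zero[OF toB_hom ring_free ring_algB, symmetric] by simp

lemma carrier_algB: "carrier algB = range toB"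
  by (auto simp: algB_def FactRing_def A_RCOSETS_def')

lemma toB_eq_iff: "toB f = toB g \<longleftrightarrow> f - g \<in> J12"
  by (rule coset_free_eq_iff[OF genideal_free_ideal])

section \<open>The augmentation ideal of B and its powers\<close>

lemma augB_toB: "augB (toB f) = Poly_Mapping.lookup f []"
  by (simp add: augB_coset eval_free_0)

lemma ideal_IB: "ideal IB (algB :: (gen, 'k::comm_ring_1) free_alg set ring)"
proof -
  have "augB \<in> ring_hom algB (ring_of_type_algebra :: 'k ring)"
    by (rule ring_hom_memI)
       (auto simp: carrier_algB toB_mult toB_add toB_one augB_toB lookup_mult_Nil lookup_add
         lookup_one zero_list_def)
  then have "ring_hom_ring algB (ring_of_type_algebra :: 'k ring) augB"
    by (intro ring_hom_ringI2 ring_algB ring_from_type_algebra)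
  then show ?thesis unfolding IB_def by (rule ring_hom_ring.kernel_is_ideal)
qed

lemma toB_in_IB_iff: "toB f \<in> IB \<longleftrightarrow> f \<in> order_ge 1"
  by (auto simp: IB_def a_kernel_def' carrier_algB augB_toB order_ge_iff)

text \<open>Both forms serve in \<open>IB_pow_fixed\<close>, where one product gains its factor from
  the ideal on the right and the other on the left.\<close>

lemma IB_pow_Suc:
  "IB [^]\<^bsub>ideals_set algB\<^esub> Suc n = ideal_prod algB (IB [^]\<^bsub>ideals_set algB\<^esub> n) IB"
  "IB [^]\<^bsub>ideals_set algB\<^esub> Suc n = ideal_prod algB IB (IB [^]\<^bsub>ideals_set algB\<^esub> n)"
proof -
  interpret I: Group.monoid "ideals_set algB" by (rule ring.monoid_ideals_set[OF ring_algB])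
  have "IB \<in> carrier (ideals_set algB)" by (simp add: ideals_set_def ideal_IB)
  then show "IB [^]\<^bsub>ideals_set algB\<^esub> Suc n = ideal_prod algB (IB [^]\<^bsub>ideals_set algB\<^esub> n) IB"
    "IB [^]\<^bsub>ideals_set algB\<^esub> Suc n = ideal_prod algB IB (IB [^]\<^bsub>ideals_set algB\<^esub> n)"
    using I.nat_pow_Suc2[of IB n] by (simp_all add: ideals_set_def)
qed

lemma IB_pow_0: "IB [^]\<^bsub>ideals_set algB\<^esub> (0::nat) = carrier algB"
  by (simp add: ideals_set_def nat_pow_def)

lemma ideal_IB_pow: "ideal (IB [^]\<^bsub>ideals_set algB\<^esub> (n::nat)) algB"
  by (induction n)
     (auto simp only: IB_pow_0 IB_pow_Suc(1) intro: ring.oneideal ring.ideal_prod_is_ideal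
       ring_algB ideal_IB)

lemma ideal_IB_inf: "ideal IB_inf algB"
  unfolding IB_inf_def by (rule ring.i_Intersect[OF ring_algB]) (auto intro: ideal_IB_pow)

text \<open>Representatives of order \<open>n\<close> and 1 multiply to one of order
  \<open>n + 1\<close>, and sums keep the order.\<close>

lemma IB_pow_order_ge:
  "S \<in> IB [^]\<^bsub>ideals_set algB\<^esub> (n::nat) \<Longrightarrow> \<exists>f\<in>order_ge n. S = toB f"
proof (induction n arbitrary: S)
  case 0
  then show ?case unfolding IB_pow_0 carrier_algB by auto
next
  case (Suc n)
  from Suc.prems[unfolded IB_pow_Suc(1)] show ?case
  proof induction
    case (prod i j)
    obtain f where f: "f \<in> order_ge n" "i = toB f" using Suc.IH[OF prod(1)] by blast
    have "j \<in> carrier algB" using prod(2) by (rule ideal.Icarr[OF ideal_IB])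
    then obtain g where g: "j = toB g" by (auto simp: carrier_algB)
    with prod(2) have "g \<in> order_ge 1" by (simp only: toB_in_IB_iff)
    with f(1) have "f * g \<in> order_ge (n + 1)" by (rule order_ge_mult)
    then show ?case using f(2) g by (intro bexI[of _ "f * g"]) (simp_all add: toB_mult)
  next
    case (sum s1 s2)
    then show ?case by (metis toB_add order_ge_add)
  qed
qed

text \<open>If \<open>r\<close> lies in the \<open>n\<close>-th power, then \<open>r b + a r\<close>
  lies in the next one, and it equals \<open>r\<close> in \<open>B\<close>.\<close>

lemma IB_pow_fixed:
  assumes "toB r = toB (r * b + a * r)" "a \<in> order_ge 1" "b \<in> order_ge 1"
  shows "toB r \<in> IB [^]\<^bsub>ideals_set algB\<^esub> (n::nat)"
proof (induction n)
  case 0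
  show ?case unfolding IB_pow_0 carrier_algB by blast
next
  case (Suc n)
  have "toB r \<otimes>\<^bsub>algB\<^esub> toB b \<in> IB [^]\<^bsub>ideals_set algB\<^esub> Suc n"
    unfolding IB_pow_Suc(1) using Suc assms(3) by (intro ideal_prod.prod) (simp add: toB_in_IB_iff)+
  moreover have "toB a \<otimes>\<^bsub>algB\<^esub> toB r \<in> IB [^]\<^bsub>ideals_set algB\<^esub> Suc n"
    unfolding IB_pow_Suc(2) using Suc assms(2) by (intro ideal_prod.prod) (simp add: toB_in_IB_iff)+
  ultimately have "toB r \<otimes>\<^bsub>algB\<^esub> toB b \<oplus>\<^bsub>algB\<^esub> toB a \<otimes>\<^bsub>algB\<^esub> toB r
    \<in> IB [^]\<^bsub>ideals_set algB\<^esub> Suc n"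
    by (rule additive_subgroup.a_closed[OF ideal.axioms(1)[OF ideal_IB_pow]])
  then show ?case by (simp add: toB_mult toB_add flip: assms(1))
qed

lemma relations_J12: "r1 \<in> J12" "r2 \<in> J12"
  using genideal_free_self[of "{r1, r2}"] by auto

lemma r3_fixed: "toB r3 = toB (r3 * gvar Y2 + gvar Y1 * r3)"
proof -
  \<comment> \<open>Resolving the overlap \<open>x1 x2 x1\<close>: this word cancels between
    \<open>r1 x1\<close> and \<open>x1 r2\<close>.\<close>
  have "r3 - (r3 * gvar Y2 + gvar Y1 * r3) = r1 * gvar X1 - gvar X1 * r2"
    by (simp add: r1_def r2_def r3_def power2_eq_square algebra_simps)
  also have "\<dots> \<in> J12"
    by (intro ideal_free_diff ideal_free_mult_left ideal_free_mult_right genideal_free_ideal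
        relations_J12)
  finally show ?thesis by (simp only: toB_eq_iff)
qed

text \<open>The mirror image of \<open>r3_fixed\<close> under exchange of the indices 1 and 2, from
  the overlap \<open>x2 x1 x2\<close>.\<close>

lemma r4_fixed: "toB r4 = toB (r4 * gvar Y1 + gvar Y2 * r4)"
proof -
  have "r4 - (r4 * gvar Y1 + gvar Y2 * r4) = r2 * gvar X2 - gvar X2 * r1"
    by (simp add: r1_def r2_def r4_def power2_eq_square algebra_simps)
  also have "\<dots> \<in> J12"
    by (intro ideal_free_diff ideal_free_mult_left ideal_free_mult_right genideal_free_ideal
        relations_J12)
  finally show ?thesis by (simp only: toB_eq_iff)
qed

section \<open>The natural surjection onto A and its kernel\<close>

lemma natA_hom: "(natA :: (gen, 'k::comm_ring_1) free_alg \<Rightarrow> _) \<in> ring_hom free_ring algA"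
proof -
  have *: "natA = (+>\<^bsub>algB\<^esub>) IB_inf \<circ> (toB :: (gen, 'k) free_alg \<Rightarrow> _)"
    by (simp add: natA_def fun_eq_iff)
  show ?thesis unfolding algA_def *
    by (rule ring_hom_trans[OF toB_hom ideal.rcos_ring_hom[OF ideal_IB_inf]])
qed

lemma natA_surj: "natA ` carrier free_ring = carrier algA"
  by (auto simp: algA_def FactRing_def A_RCOSETS_def' carrier_algB natA_def)

lemma ring_algA: "ring algA"
  unfolding algA_def by (rule ideal.quotient_is_ring[OF ideal_IB_inf])

lemma natA_kernel_iff: "f \<in> a_kernel free_ring algA natA \<longleftrightarrow> toB f \<in> IB_inf"
proof -
  interpret I: ideal IB_inf algB by (rule ideal_IB_inf)
  have "toB f \<in> carrier algB" by (simp add: carrier_algB)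
  then have "IB_inf +>\<^bsub>algB\<^esub> toB f = IB_inf \<longleftrightarrow> toB f \<in> IB_inf"
    using I.a_rcos_self I.a_rcos_const by blast
  then show ?thesis by (simp add: a_kernel_def' natA_def algA_def FactRing_def)
qed

lemma J12_subset:
  "(J12 :: (gen, 'k::comm_ring_1) free_alg set) \<subseteq> genideal free_ring {r1, r2, r3, r4}"
proof (rule genideal_free_minimal[OF genideal_free_ideal])
  show "{r1, r2} \<subseteq> genideal free_ring {r1, r2, r3, r4 :: (gen, 'k) free_alg}"
    using genideal_free_self[of "{r1, r2, r3, r4 :: (gen, 'k) free_alg}"] by blast
qed

text \<open>\<open>r1\<close> and \<open>r2\<close> already vanish in \<open>B\<close>;
  \<open>r3\<close> and \<open>r4\<close> satisfy fixed-point equations with coefficients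
  \<open>y1\<close>, \<open>y2\<close>, which put them into every power of
  \<open>IB\<close>.\<close>

lemma relations_natA_kernel:
  "{r1, r2, r3, r4 :: (gen, 'k::comm_ring_1) free_alg} \<subseteq> a_kernel free_ring algA natA"
proof -
  have "r \<in> a_kernel free_ring algA natA" if "r \<in> J12" for r :: "(gen, 'k) free_alg"
  proof -
    from that have "toB r = \<zero>\<^bsub>algB\<^esub>" unfolding toB_zero toB_eq_iff by simp
    then show ?thesis unfolding natA_kernel_iff
      using additive_subgroup.zero_closed[OF ideal.axioms(1)[OF ideal_IB_inf]] by (simp only:)
  qed
  moreover have "r3 \<in> a_kernel free_ring algA natA" "r4 \<in> a_kernel free_ring algA natA"
    unfolding natA_kernel_iff IB_inf_def
    by (intro INT_I IB_pow_fixed[OF r3_fixed] IB_pow_fixed[OF r4_fixed] gvar_order_ge)+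
  ultimately show ?thesis using relations_J12 by blast
qed

text \<open>An element mapped into all powers of \<open>IB\<close> is congruent, modulo the ideal of
  the four relations, to elements of arbitrarily high order; \<open>residually_nilpotent\<close>
  then applies. The other inclusion is minimality of the generated ideal.\<close>

lemma natA_kernel:
  "a_kernel (free_ring :: (gen, 'k::comm_ring_1) free_alg ring) algA natA =
    genideal free_ring {r1, r2, r3, r4}"
  (is "?ker = ?K")
proof (rule subset_antisym)
  show "?ker \<subseteq> ?K"
  proof
    fix f :: "(gen, 'k) free_alg"
    assume "f \<in> ?ker"
    then have f: "toB f \<in> IB_inf" by (simp only: natA_kernel_iff)
    show "f \<in> ?K"
    proof (rule residually_nilpotent)
      fix n :: nat
      assume "n \<ge> 1"
      with f have "toB f \<in> IB [^]\<^bsub>ideals_set algB\<^esub> n" by (simp add: IB_inf_def)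
      then obtain g where g: "g \<in> order_ge n" "toB f = toB g" using IB_pow_order_ge by blast
      then have "f - g \<in> ?K" using J12_subset unfolding toB_eq_iff by blast
      with g(1) show "\<exists>g\<in>order_ge n. f - g \<in> ?K" ..
    qed
  qed
  have "ideal ?ker free_ring"
    by (intro ring_hom_ring.kernel_is_ideal ring_hom_ringI2 ring_free ring_algA natA_hom)
  then show "?K \<subseteq> ?ker"
    using relations_natA_kernel by (rule genideal_free_minimal)
qed

theorem lemma6p1:
  shows "(natA :: (gen, 'k::comm_ring_1) free_alg \<Rightarrow> (gen, 'k) free_alg set set)
           \<in> ring_hom free_ring algA
       \<and> natA ` carrier (free_ring :: (gen, 'k) free_alg ring) = carrier algA
       \<and> a_kernel (free_ring :: (gen, 'k) free_alg ring) algA natA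
           = genideal free_ring {r1, r2, r3, r4}
       \<and> GS_basis deglex {r1 :: (gen, 'k) free_alg, r2, r3, r4}"
  using natA_hom natA_surj natA_kernel GS_basis_relations by blast

end
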